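(* Let $n\ge1$, $x_0\in\mathbb{R}^d$, $\bar\Delta>0$. For $i\in\{1,\dots,n\}$ let $f_i:\mathbb{R}^d\to\mathbb{R}$ be in $\mathcal{C}^2$ and let $\{\widetilde f_{i,\Delta}\}_{\Delta\in(0,\bar\Delta]}$ be a class of (twice differentiable) models of $f_i$ that provides order-$N_i^f$ function accuracy, order-$N_i^g$ gradient accuracy and order-$N_i^h$ Hessian accuracy of $f_i$ near $x_0$, where $N_i^f,N_i^g,N_i^h\ge0$. Put $F=f_1\cdots f_n$ and $\widetilde F_\Delta=\widetilde f_{1,\Delta}\cdots\widetilde f_{n,\Delta}$. Then $\{\widetilde F_\Delta\}_{(0,\bar\Delta]}$ provides order-$N_F^{fgh}$ Hessian accuracy of $F$ near $x_0$, where $N_F^{fgh}=\min\{N_i^f,N_i^g,N_i^h:i=1,\dots,n\}$.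
   Context: $\|\cdot\|$ is the Euclidean norm for vectors and the induced operator norm for matrices; $B_\Delta(x_0)$ is the closed ball of radius $\Delta$ centered at $x_0$. A class of models of $f:\mathbb{R}^d\to\mathbb{R}$ is a family of functions $\widetilde f_\Delta:\mathbb{R}^d\to\mathbb{R}$ indexed by $\Delta\in(0,\bar\Delta]$; when gradients or Hessians of models appear the models are understood to be differentiable, respectively twice differentiable. For real $N\ge0$, the class provides order-$N$ function (respectively gradient, Hessian) accuracy of $f$ near $x_0$ if there is $\kappa\ge0$ such that for all $\Delta\in(0,\bar\Delta]$ and $x\in B_\Delta(x_0)$ one has $|f(x)-\widetilde f_\Delta(x)|\le\kappa\Delta^N$ (respectively $\|\nabla f(x)-\nabla\widetilde f_\Delta(x)\|\le\kappa\Delta^N$, $\|\nabla^2f(x)-\nabla^2\widetilde f_\Delta(x)\|\le\kappa\Delta^N$). *)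

theory Defs
  imports "HOL-Analysis.Analysis"
begin

text \<open>The gradient is a total function; its value is meaningful only where \<open>f\<close> is
  (Frechet) differentiable. The same caveat applies to the Hessian below.\<close>

definition gradient :: "(real ^ 'd \<Rightarrow> real) \<Rightarrow> real ^ 'd \<Rightarrow> real ^ 'd" where
  "gradient f x = (THE D. GDERIV f x :> D)"

definition hessian :: "(real ^ 'd \<Rightarrow> real) \<Rightarrow> real ^ 'd \<Rightarrow> real ^ 'd ^ 'd" where
  "hessian f x = jacobian (gradient f) (at x)"

definition twice_differentiable :: "(real ^ 'd \<Rightarrow> real) \<Rightarrow> bool" where
  "twice_differentiable f \<longleftrightarrow>
     (\<forall>x. f differentiable (at x)) \<and> (\<forall>x. gradient f differentiable (at x))"

definition C2_function :: "(real ^ 'd \<Rightarrow> real) \<Rightarrow> bool" where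
  "C2_function f \<longleftrightarrow> twice_differentiable f \<and> continuous_on UNIV (hessian f)"

text \<open>The norm of type class \<open>real_normed_vector\<close> on matrices is the Frobenius norm, so the
  operator norm induced by the Euclidean norm is spelled out.\<close>

definition matrix_opnorm :: "real ^ 'd ^ 'd \<Rightarrow> real" where
  "matrix_opnorm A = onorm (\<lambda>v. A *v v)"

text \<open>A class of models is a family \<open>m :: real \<Rightarrow> real ^ 'd \<Rightarrow> real\<close>, where \<open>m \<Delta>\<close> matters only for
  \<open>\<Delta>\<close> in \<open>{0<..D}\<close>. Since \<open>0 < \<Delta>\<close>, \<open>\<Delta> powr N\<close> is the usual real power, with \<open>\<Delta> powr 0 = 1\<close>.
  Gradient and Hessian accuracy include the existence of the derivatives they compare.\<close>

definition function_accuracy ::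
  "real \<Rightarrow> (real ^ 'd \<Rightarrow> real) \<Rightarrow> real ^ 'd \<Rightarrow> real \<Rightarrow> (real \<Rightarrow> real ^ 'd \<Rightarrow> real) \<Rightarrow> bool" where
  "function_accuracy N f x0 D m \<longleftrightarrow>
     (\<exists>\<kappa>\<ge>0. \<forall>\<Delta>\<in>{0<..D}. \<forall>x\<in>cball x0 \<Delta>. \<bar>f x - m \<Delta> x\<bar> \<le> \<kappa> * \<Delta> powr N)"

definition gradient_accuracy ::
  "real \<Rightarrow> (real ^ 'd \<Rightarrow> real) \<Rightarrow> real ^ 'd \<Rightarrow> real \<Rightarrow> (real \<Rightarrow> real ^ 'd \<Rightarrow> real) \<Rightarrow> bool" where
  "gradient_accuracy N f x0 D m \<longleftrightarrow>
     (\<forall>x. f differentiable (at x)) \<and> (\<forall>\<Delta>\<in>{0<..D}. \<forall>x. m \<Delta> differentiable (at x)) \<and>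
     (\<exists>\<kappa>\<ge>0. \<forall>\<Delta>\<in>{0<..D}. \<forall>x\<in>cball x0 \<Delta>.
        norm (gradient f x - gradient (m \<Delta>) x) \<le> \<kappa> * \<Delta> powr N)"

definition hessian_accuracy ::
  "real \<Rightarrow> (real ^ 'd \<Rightarrow> real) \<Rightarrow> real ^ 'd \<Rightarrow> real \<Rightarrow> (real \<Rightarrow> real ^ 'd \<Rightarrow> real) \<Rightarrow> bool" where
  "hessian_accuracy N f x0 D m \<longleftrightarrow>
     twice_differentiable f \<and> (\<forall>\<Delta>\<in>{0<..D}. twice_differentiable (m \<Delta>)) \<and>
     (\<exists>\<kappa>\<ge>0. \<forall>\<Delta>\<in>{0<..D}. \<forall>x\<in>cball x0 \<Delta>.
        matrix_opnorm (hessian f x - hessian (m \<Delta>) x) \<le> \<kappa> * \<Delta> powr N)"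

end

theory Submission
  imports Defs
begin

text \<open>By induction on the number of factors it suffices to treat \<open>f \<cdot> g\<close>. There
  \<open>\<nabla>(fg) = f \<nabla>g + g \<nabla>f\<close> and
  \<open>\<nabla>\<^sup>2(fg) = f \<nabla>\<^sup>2g + \<nabla>g \<nabla>f\<^sup>T + g \<nabla>\<^sup>2f + \<nabla>f \<nabla>g\<^sup>T\<close> are sums of bilinear expressions in functions that
  are continuous, hence bounded on the ball of radius \<open>Dbar\<close>, and a bilinear expression in two
  bounded quantities known up to \<open>O(\<Delta>\<^sup>N)\<close> is again known up to \<open>O(\<Delta>\<^sup>N)\<close>. Here \<open>N\<close> is the
  minimal order, and on matrices the Frobenius norm may replace the operator norm.\<close>

section \<open>Gradients and Hessians of products\<close>

text \<open>Makes the definite description in \<open>gradient\<close> well defined: a vector is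
  determined by its inner products with all other vectors.\<close>

lemma GDERIV_unique:
  assumes "GDERIV f x :> D" "GDERIV f x :> D'"
  shows "D = D'"
proof -
  have "h \<bullet> D = h \<bullet> D'" for h
    using has_derivative_unique[OF assms[unfolded gderiv_def]] by (rule fun_cong)
  then show ?thesis by (metis vector_eq_ldot)
qed

lemma gradient_eq: "GDERIV f x :> D \<Longrightarrow> gradient f x = D"
  unfolding gradient_def by (rule the_equality) (auto intro: GDERIV_unique)

text \<open>A linear functional on a finite-dimensional space is the inner product with the vector
  of its values on the standard basis, so every Frechet derivative comes from a gradient.\<close>

lemma differentiable_imp_GDERIV:
  fixes f :: "real ^ 'd \<Rightarrow> real"
  assumes "f differentiable (at x)"
  shows "GDERIV f x :> gradient f x"
proof -
  obtain f' where f': "(f has_derivative f') (at x)"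
    using assms by (auto simp: differentiable_def)
  define D where "D = (\<chi> i. f' (axis i 1))"
  have "f' h = h \<bullet> D" for h
  proof -
    have "f' h = f' (\<Sum>i\<in>UNIV. h $ i *\<^sub>R axis i 1)"
      by (simp add: basis_expansion scalar_mult_eq_scaleR[symmetric])
    also have "\<dots> = (\<Sum>i\<in>UNIV. h $ i * f' (axis i 1))"
      using has_derivative_linear[OF f'] by (simp add: linear_sum linear_scale)
    finally show ?thesis by (simp add: D_def inner_vec_def)
  qed
  then have "f' = (\<lambda>h. h \<bullet> D)"
    by (rule ext)
  then have "GDERIV f x :> D"
    using f' by (simp add: gderiv_def)
  then show ?thesis using gradient_eq by metis
qed

lemma gradient_mult:
  fixes f g :: "real ^ 'd \<Rightarrow> real"
  assumes "\<And>x. f differentiable (at x)" "\<And>x. g differentiable (at x)"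
  shows "gradient (\<lambda>x. f x * g x) = (\<lambda>x. f x *\<^sub>R gradient g x + g x *\<^sub>R gradient f x)"
  by (intro ext gradient_eq GDERIV_mult differentiable_imp_GDERIV assms)

text \<open>The rank-one matrix u v^T. It sends h to (v . h) u, which is the shape of the term that
  arises when the scalar factor of a scaled gradient is differentiated.\<close>

definition outer_product :: "real ^ 'm \<Rightarrow> real ^ 'n \<Rightarrow> real ^ 'n ^ 'm" where
  "outer_product u v = (\<chi> i j. u $ i * v $ j)"

lemma bounded_bilinear_outer_product:
  "bounded_bilinear (outer_product :: real ^ 'm \<Rightarrow> real ^ 'n \<Rightarrow> real ^ 'n ^ 'm)"
  unfolding bilinear_conv_bounded_bilinear[symmetric] bilinear_def linear_iff
  by (auto simp: outer_product_def vec_eq_iff algebra_simps)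

lemma hessian_eq: "(gradient f has_derivative (*v) H) (at x) \<Longrightarrow> hessian f x = H"
  unfolding hessian_def jacobian_def
  by (metis frechet_derivative_at matrix_of_matrix_vector_mul)

lemma twice_differentiableD:
  assumes "twice_differentiable f"
  shows "(f has_derivative (\<lambda>h. h \<bullet> gradient f x)) (at x)"
    and "(gradient f has_derivative (*v) (hessian f x)) (at x)"
  using assms differentiable_imp_GDERIV[of f x] jacobian_works[of "gradient f" "at x"]
  by (auto simp: twice_differentiable_def gderiv_def hessian_def inner_commute)

text \<open>The product rule is applied to the two summands of the gradient of the product. Each of
  them gives a scaled Hessian and a rank-one matrix, and the brackets keep these two
  together.\<close>

lemma hessian_mult:
  fixes f g :: "real ^ 'd \<Rightarrow> real"
  assumes f: "twice_differentiable f" and g: "twice_differentiable g"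
  shows "twice_differentiable (\<lambda>x. f x * g x)" (is ?A)
    and "hessian (\<lambda>x. f x * g x) = (\<lambda>x.
      (f x *\<^sub>R hessian g x + outer_product (gradient g x) (gradient f x)) +
      (g x *\<^sub>R hessian f x + outer_product (gradient f x) (gradient g x)))" (is "_ = ?H")
proof -
  have grad: "gradient (\<lambda>x. f x * g x) = (\<lambda>x. f x *\<^sub>R gradient g x + g x *\<^sub>R gradient f x)"
    using f g by (intro gradient_mult) (auto simp: twice_differentiable_def)
  have der: "(gradient (\<lambda>x. f x * g x) has_derivative (*v) (?H x)) (at x)" for x
    unfolding grad
    \<comment> \<open>The derivative rules produce some derivative of the right-hand side; what
      remains is that it agrees with multiplication by the matrix, checked componentwise.\<close>
    by (rule has_derivative_eq_rhs, (rule derivative_intros twice_differentiableD f g)+)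
      (simp add: fun_eq_iff vec_eq_iff outer_product_def matrix_vector_mult_def inner_vec_def
        algebra_simps sum.distrib sum_distrib_left)
  show ?A
    using f g der unfolding twice_differentiable_def
    by (auto intro: differentiable_mult simp: differentiable_def[of "gradient _"])
  show "hessian (\<lambda>x. f x * g x) = ?H"
    by (intro ext hessian_eq der)
qed

lemma gradient_const: "gradient (\<lambda>_. c) = (\<lambda>_. 0)"
  by (intro ext gradient_eq GDERIV_const)

lemma hessian_const: "hessian (\<lambda>_ :: real ^ 'd. c) = (\<lambda>_. 0)"
proof (intro ext hessian_eq)
  have "(*v) (0 :: real ^ 'd ^ 'd) = (\<lambda>_. 0)" by (simp add: fun_eq_iff)
  then show "(gradient (\<lambda>_ :: real ^ 'd. c) has_derivative (*v) 0) (at x)" for x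
    by (simp add: gradient_const)
qed

lemma C2_function_const: "C2_function (\<lambda>_. c)"
  by (simp add: C2_function_def twice_differentiable_def hessian_const gradient_const)

text \<open>Only continuity of the Hessian is part of the definition; the function and its gradient
  are continuous because they are differentiable.\<close>

lemma C2_function_continuous:
  assumes "C2_function f"
  shows "continuous_on S f" "continuous_on S (gradient f)" "continuous_on S (hessian f)"
  using assms
  by (auto simp: C2_function_def twice_differentiable_def intro: continuous_on_subset
      differentiable_imp_continuous_on differentiable_at_imp_differentiable_on)

lemma C2_function_mult:
  assumes "C2_function f" "C2_function g"
  shows "C2_function (\<lambda>x. f x * g x)"
  using assms hessian_mult[of f g] C2_function_continuous[of f UNIV] C2_function_continuous[of g UNIV]
  by (auto simp: C2_function_def intro!: continuous_intros
      bounded_bilinear.continuous_on[OF bounded_bilinear_outer_product])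

section \<open>Approximation to a given order\<close>

text \<open>The codomain is an arbitrary normed space, so that values, gradients and Hessians share
  the same lemmas. On matrices \<open>norm\<close> is the Frobenius norm.\<close>

definition accurate_to_order ::
  "real \<Rightarrow> 'a::metric_space \<Rightarrow> real \<Rightarrow> ('a \<Rightarrow> 'b::real_normed_vector) \<Rightarrow> (real \<Rightarrow> 'a \<Rightarrow> 'b) \<Rightarrow> bool"
  where "accurate_to_order N x0 D a b \<longleftrightarrow>
    (\<exists>\<kappa>\<ge>0. \<forall>\<Delta>\<in>{0<..D}. \<forall>x\<in>cball x0 \<Delta>. norm (a x - b \<Delta> x) \<le> \<kappa> * \<Delta> powr N)"

lemma accurate_to_orderI:
  assumes "\<kappa> \<ge> 0"
    and "\<And>\<Delta> x. 0 < \<Delta> \<Longrightarrow> \<Delta> \<le> D \<Longrightarrow> x \<in> cball x0 \<Delta> \<Longrightarrow> norm (a x - b \<Delta> x) \<le> \<kappa> * \<Delta> powr N"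
  shows "accurate_to_order N x0 D a b"
  using assms unfolding accurate_to_order_def by (intro exI[of _ \<kappa>]) auto

lemma accurate_to_orderE:
  assumes "accurate_to_order N x0 D a b"
  obtains \<kappa> where "\<kappa> \<ge> 0"
    and "\<And>\<Delta> x. 0 < \<Delta> \<Longrightarrow> \<Delta> \<le> D \<Longrightarrow> x \<in> cball x0 \<Delta> \<Longrightarrow> norm (a x - b \<Delta> x) \<le> \<kappa> * \<Delta> powr N"
  using assms unfolding accurate_to_order_def by force

lemma accurate_to_order_refl: "accurate_to_order N x0 D a (\<lambda>_. a)"
  by (rule accurate_to_orderI[of 0]) auto

text \<open>Product formulas for models hold only at radii where the models are known to be
  differentiable, so rewriting has to be restricted to those radii.\<close>

lemma accurate_to_order_cong:
  assumes "accurate_to_order N x0 D a b" "\<And>\<Delta>. 0 < \<Delta> \<Longrightarrow> \<Delta> \<le> D \<Longrightarrow> b \<Delta> = b' \<Delta>"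
  shows "accurate_to_order N x0 D a b'"
proof -
  obtain \<kappa> where \<kappa>: "\<kappa> \<ge> 0"
    "\<And>\<Delta> x. 0 < \<Delta> \<Longrightarrow> \<Delta> \<le> D \<Longrightarrow> x \<in> cball x0 \<Delta> \<Longrightarrow> norm (a x - b \<Delta> x) \<le> \<kappa> * \<Delta> powr N"
    by (fact accurate_to_orderE[OF assms(1)])
  show ?thesis
    by (rule accurate_to_orderI[OF \<kappa>(1)]) (simp only: \<kappa>(2) assms(2)[symmetric])
qed

text \<open>The radii are bounded by \<open>D\<close>, so the surplus factor
  \<open>\<Delta> powr (N' - N)\<close> is at most \<open>D powr (N' - N)\<close> and can be
  absorbed into the constant.\<close>

lemma accurate_to_order_mono:
  assumes "accurate_to_order N' x0 D a b" and "N \<le> N'"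
  shows "accurate_to_order N x0 D a b"
proof -
  obtain \<kappa> where \<kappa>: "\<kappa> \<ge> 0"
    "\<And>\<Delta> x. 0 < \<Delta> \<Longrightarrow> \<Delta> \<le> D \<Longrightarrow> x \<in> cball x0 \<Delta> \<Longrightarrow> norm (a x - b \<Delta> x) \<le> \<kappa> * \<Delta> powr N'"
    by (fact accurate_to_orderE[OF assms(1)])
  show ?thesis
  proof (rule accurate_to_orderI)
    fix \<Delta> x assume \<Delta>: "0 < \<Delta>" "\<Delta> \<le> D" "x \<in> cball x0 \<Delta>"
    have "\<Delta> powr N' = \<Delta> powr (N' - N) * \<Delta> powr N"
      by (simp add: powr_add[symmetric])
    also have "\<dots> \<le> D powr (N' - N) * \<Delta> powr N"
      using \<Delta> assms(2) by (intro mult_right_mono powr_mono2) auto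
    finally have "\<kappa> * \<Delta> powr N' \<le> \<kappa> * (D powr (N' - N) * \<Delta> powr N)"
      using \<kappa>(1) by (rule mult_left_mono)
    then show "norm (a x - b \<Delta> x) \<le> \<kappa> * D powr (N' - N) * \<Delta> powr N"
      using \<kappa>(2)[OF \<Delta>] by (simp add: mult.assoc)
  qed (use \<kappa>(1) in simp)
qed

lemma accurate_to_order_add:
  assumes "accurate_to_order N x0 D a b" and "accurate_to_order N x0 D c d"
  shows "accurate_to_order N x0 D (\<lambda>x. a x + c x) (\<lambda>\<Delta> x. b \<Delta> x + d \<Delta> x)"
proof -
  obtain \<kappa> where \<kappa>: "\<kappa> \<ge> 0"
    "\<And>\<Delta> x. 0 < \<Delta> \<Longrightarrow> \<Delta> \<le> D \<Longrightarrow> x \<in> cball x0 \<Delta> \<Longrightarrow> norm (a x - b \<Delta> x) \<le> \<kappa> * \<Delta> powr N"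
    by (fact accurate_to_orderE[OF assms(1)])
  obtain l where l: "l \<ge> 0"
    "\<And>\<Delta> x. 0 < \<Delta> \<Longrightarrow> \<Delta> \<le> D \<Longrightarrow> x \<in> cball x0 \<Delta> \<Longrightarrow> norm (c x - d \<Delta> x) \<le> l * \<Delta> powr N"
    by (fact accurate_to_orderE[OF assms(2)])
  show ?thesis
  proof (rule accurate_to_orderI[of "\<kappa> + l"])
    fix \<Delta> x assume \<Delta>: "0 < \<Delta>" "\<Delta> \<le> D" "x \<in> cball x0 \<Delta>"
    show "norm (a x + c x - (b \<Delta> x + d \<Delta> x)) \<le> (\<kappa> + l) * \<Delta> powr N"
      using norm_diff_triangle_ineq[of "a x" "c x" "b \<Delta> x" "d \<Delta> x"] \<kappa>(2)[OF \<Delta>] l(2)[OF \<Delta>]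
      by (simp add: distrib_right)
  qed (use \<kappa> l in simp)
qed

text \<open>The error splits as B(a - b, d) + B(a, c - d). In each term one argument is small and
  the other is bounded: \<open>a\<close> by assumption, \<open>d\<close> because it stays close to
  the bounded \<open>c\<close>.\<close>

lemma accurate_to_order_bilinear:
  assumes bil: "bounded_bilinear B" and "N \<ge> 0"
    and ab: "accurate_to_order N x0 D a b" and cd: "accurate_to_order N x0 D c d"
    and bdd: "bounded (a ` cball x0 D)" "bounded (c ` cball x0 D)"
  shows "accurate_to_order N x0 D (\<lambda>x. B (a x) (c x)) (\<lambda>\<Delta> x. B (b \<Delta> x) (d \<Delta> x))"
proof -
  interpret bounded_bilinear B by (rule bil)
  obtain \<kappa> where \<kappa>: "\<kappa> \<ge> 0"
    "\<And>\<Delta> x. 0 < \<Delta> \<Longrightarrow> \<Delta> \<le> D \<Longrightarrow> x \<in> cball x0 \<Delta> \<Longrightarrow> norm (a x - b \<Delta> x) \<le> \<kappa> * \<Delta> powr N"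
    by (fact accurate_to_orderE[OF ab])
  obtain l where l: "l \<ge> 0"
    "\<And>\<Delta> x. 0 < \<Delta> \<Longrightarrow> \<Delta> \<le> D \<Longrightarrow> x \<in> cball x0 \<Delta> \<Longrightarrow> norm (c x - d \<Delta> x) \<le> l * \<Delta> powr N"
    by (fact accurate_to_orderE[OF cd])
  obtain A where A: "A > 0" "\<And>x. x \<in> cball x0 D \<Longrightarrow> norm (a x) \<le> A"
    using bdd(1) by (auto simp: bounded_pos)
  obtain C where C: "C > 0" "\<And>x. x \<in> cball x0 D \<Longrightarrow> norm (c x) \<le> C"
    using bdd(2) by (auto simp: bounded_pos)
  obtain K where K: "K \<ge> 0" "\<And>u v. norm (B u v) \<le> norm u * norm v * K"
    using nonneg_bounded by blast
  show ?thesis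
  proof (rule accurate_to_orderI)
    fix \<Delta> x assume \<Delta>: "0 < \<Delta>" "\<Delta> \<le> D" "x \<in> cball x0 \<Delta>"
    define p where "p = \<Delta> powr N"
    have x: "x \<in> cball x0 D" using \<Delta> by auto
    \<comment> \<open>Since \<open>N \<ge> 0\<close>, the power is increasing in the radius; this
      makes the bound on \<open>d \<Delta> x\<close> below uniform in \<Delta>.\<close>
    have p: "0 \<le> p" "p \<le> D powr N"
      using \<Delta> \<open>N \<ge> 0\<close> by (auto simp: p_def intro: powr_mono2)
    have ea: "norm (a x - b \<Delta> x) \<le> \<kappa> * p" and ec: "norm (c x - d \<Delta> x) \<le> l * p"
      using \<kappa>(2)[OF \<Delta>] l(2)[OF \<Delta>] by (auto simp: p_def)
    have "norm (d \<Delta> x) \<le> norm (c x) + norm (c x - d \<Delta> x)"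
      by (metis norm_minus_commute norm_triangle_sub)
    also have "\<dots> \<le> C + l * D powr N"
      using C(2)[OF x] ec p l(1) mult_left_mono[of p "D powr N" l] by linarith
    finally have d: "norm (d \<Delta> x) \<le> C + l * D powr N" .
    have "B (a x) (c x) - B (b \<Delta> x) (d \<Delta> x) =
        B (a x - b \<Delta> x) (d \<Delta> x) + B (a x) (c x - d \<Delta> x)"
      by (simp add: diff_left diff_right)
    also have "norm \<dots> \<le> norm (a x - b \<Delta> x) * norm (d \<Delta> x) * K
        + norm (a x) * norm (c x - d \<Delta> x) * K"
      by (rule order_trans[OF norm_triangle_ineq add_mono[OF K(2) K(2)]])
    also have "\<dots> \<le> (\<kappa> * p) * (C + l * D powr N) * K + A * (l * p) * K"
      using ea ec d A C(1) x \<kappa>(1) l(1) p K(1)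
      by (intro add_mono mult_mono mult_nonneg_nonneg add_nonneg_nonneg) (auto intro: less_imp_le)
    \<comment> \<open>This also fixes the constant that \<open>accurate_to_orderI\<close> left open;
      it depends on neither \<Delta> nor \<open>x\<close>.\<close>
    finally show "norm (B (a x) (c x) - B (b \<Delta> x) (d \<Delta> x))
        \<le> (\<kappa> * (C + l * D powr N) * K + A * l * K) * \<Delta> powr N"
      by (simp add: p_def algebra_simps)
  qed (use \<kappa> l A C K in \<open>auto intro!: add_nonneg_nonneg mult_nonneg_nonneg\<close>)
qed

section \<open>Frobenius norm and operator norm\<close>

text \<open>Each entry is bounded by the operator norm; summing over the entries of a row and then
  over the rows costs the square of the dimension.\<close>

lemma norm_le_matrix_opnorm:
  fixes A :: "real ^ 'd ^ 'd"
  shows "norm A \<le> (real CARD('d))\<^sup>2 * matrix_opnorm A"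
proof -
  have "\<bar>A $ i $ j\<bar> \<le> matrix_opnorm A" for i j
    using matrix_component_le_onorm[of A i j] by (simp add: matrix_opnorm_def)
  then have row: "norm (A $ i) \<le> real CARD('d) * matrix_opnorm A" for i
    using norm_le_l1_cart[of "A $ i"] sum_bounded_above[of UNIV "\<lambda>j. \<bar>A $ i $ j\<bar>"]
    by (meson order_trans UNIV_I)
  have "norm A \<le> (\<Sum>i\<in>UNIV. norm (A $ i))"
    by (simp add: norm_vec_def L2_set_le_sum)
  also have "\<dots> \<le> real CARD('d) * (real CARD('d) * matrix_opnorm A)"
    using row by (intro sum_bounded_above)
  finally show ?thesis by (simp add: power2_eq_square mult.assoc)
qed

text \<open>Each entry is bounded by the Frobenius norm, and a uniform bound on the entries bounds
  the operator norm up to the number of entries.\<close>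

lemma matrix_opnorm_le_norm:
  fixes A :: "real ^ 'd ^ 'd"
  shows "matrix_opnorm A \<le> (real CARD('d))\<^sup>2 * norm A"
proof -
  have "\<bar>A $ i $ j\<bar> \<le> norm A" for i j
    by (meson component_le_norm_cart Finite_Cartesian_Product.norm_nth_le order_trans)
  from onorm_le_matrix_component[OF this] show ?thesis
    by (simp add: matrix_opnorm_def power2_eq_square)
qed

text \<open>Passing between the two equivalent matrix norms changes only the constant, by the square
  of the dimension, and not the order.\<close>

lemma hessian_accuracy_iff:
  fixes f :: "real ^ 'd \<Rightarrow> real"
  shows "hessian_accuracy N f x0 D m \<longleftrightarrow>
    twice_differentiable f \<and> (\<forall>\<Delta>\<in>{0<..D}. twice_differentiable (m \<Delta>)) \<and>
    accurate_to_order N x0 D (hessian f) (\<lambda>\<Delta>. hessian (m \<Delta>))"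
proof -
  let ?c = "(real CARD('d))\<^sup>2"
  let ?H = "\<lambda>\<Delta> x. hessian f x - hessian (m \<Delta>) x"
  have "(\<exists>\<kappa>\<ge>0. \<forall>\<Delta>\<in>{0<..D}. \<forall>x\<in>cball x0 \<Delta>. matrix_opnorm (?H \<Delta> x) \<le> \<kappa> * \<Delta> powr N) \<longleftrightarrow>
    (\<exists>\<kappa>\<ge>0. \<forall>\<Delta>\<in>{0<..D}. \<forall>x\<in>cball x0 \<Delta>. norm (?H \<Delta> x) \<le> \<kappa> * \<Delta> powr N)"
    (is "?L \<longleftrightarrow> ?R")
  proof
    assume ?L
    then obtain \<kappa> where \<kappa>: "\<kappa> \<ge> 0"
      "\<And>\<Delta> x. \<Delta> \<in> {0<..D} \<Longrightarrow> x \<in> cball x0 \<Delta> \<Longrightarrow> matrix_opnorm (?H \<Delta> x) \<le> \<kappa> * \<Delta> powr N"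
      by blast
    have "norm (?H \<Delta> x) \<le> ?c * \<kappa> * \<Delta> powr N" if "\<Delta> \<in> {0<..D}" "x \<in> cball x0 \<Delta>" for \<Delta> x
      using order_trans[OF norm_le_matrix_opnorm mult_left_mono[OF \<kappa>(2)[OF that], of ?c]]
      by (simp add: mult.assoc)
    then show ?R using \<kappa>(1) by (intro exI[of _ "?c * \<kappa>"]) auto
  next
    assume ?R
    then obtain \<kappa> where \<kappa>: "\<kappa> \<ge> 0"
      "\<And>\<Delta> x. \<Delta> \<in> {0<..D} \<Longrightarrow> x \<in> cball x0 \<Delta> \<Longrightarrow> norm (?H \<Delta> x) \<le> \<kappa> * \<Delta> powr N"
      by blast
    have "matrix_opnorm (?H \<Delta> x) \<le> ?c * \<kappa> * \<Delta> powr N"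
      if "\<Delta> \<in> {0<..D}" "x \<in> cball x0 \<Delta>" for \<Delta> x
      using order_trans[OF matrix_opnorm_le_norm mult_left_mono[OF \<kappa>(2)[OF that], of ?c]]
      by (simp add: mult.assoc)
    then show ?L using \<kappa>(1) by (intro exI[of _ "?c * \<kappa>"]) auto
  qed
  then show ?thesis
    unfolding hessian_accuracy_def accurate_to_order_def by blast
qed

section \<open>Models that are accurate to second order\<close>

text \<open>The invariant of the induction over the factors. Hessian accuracy alone would not be
  preserved by products, since the Hessian of a product involves values and gradients too.
  Continuity is asked of \<open>f\<close>, to bound it and its derivatives on the ball; the models
  inherit bounds from their accuracy.\<close>

definition C2_accurate ::
  "real \<Rightarrow> (real ^ 'd \<Rightarrow> real) \<Rightarrow> real ^ 'd \<Rightarrow> real \<Rightarrow> (real \<Rightarrow> real ^ 'd \<Rightarrow> real) \<Rightarrow> bool" where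
  "C2_accurate N f x0 D m \<longleftrightarrow>
    C2_function f \<and> (\<forall>\<Delta>\<in>{0<..D}. twice_differentiable (m \<Delta>)) \<and>
    accurate_to_order N x0 D f m \<and>
    accurate_to_order N x0 D (gradient f) (\<lambda>\<Delta>. gradient (m \<Delta>)) \<and>
    accurate_to_order N x0 D (hessian f) (\<lambda>\<Delta>. hessian (m \<Delta>))"

lemma C2_accurate_const: "C2_accurate N (\<lambda>_. c) x0 D (\<lambda>_ _. c)"
  using C2_function_const[of c]
  by (auto simp: C2_accurate_def C2_function_def accurate_to_order_refl)

lemma C2_accurate_mult:
  fixes f g :: "real ^ 'd \<Rightarrow> real"
  assumes "N \<ge> 0" and f: "C2_accurate N f x0 D m" and g: "C2_accurate N g x0 D k"
  shows "C2_accurate N (\<lambda>x. f x * g x) x0 D (\<lambda>\<Delta> x. m \<Delta> x * k \<Delta> x)"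
proof -
  have C2: "C2_function f" "C2_function g"
    and f_acc: "accurate_to_order N x0 D f m"
      "accurate_to_order N x0 D (gradient f) (\<lambda>\<Delta>. gradient (m \<Delta>))"
      "accurate_to_order N x0 D (hessian f) (\<lambda>\<Delta>. hessian (m \<Delta>))"
    and g_acc: "accurate_to_order N x0 D g k"
      "accurate_to_order N x0 D (gradient g) (\<lambda>\<Delta>. gradient (k \<Delta>))"
      "accurate_to_order N x0 D (hessian g) (\<lambda>\<Delta>. hessian (k \<Delta>))"
    using f g by (auto simp: C2_accurate_def)
  have td: "twice_differentiable f" "twice_differentiable g"
    using C2 by (auto simp: C2_function_def)
  have tdm: "twice_differentiable (m \<Delta>)" "twice_differentiable (k \<Delta>)" if "0 < \<Delta>" "\<Delta> \<le> D" for \<Delta>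
    using f g that by (auto simp: C2_accurate_def)
  \<comment> \<open>Closed balls in finite dimension are compact, which supplies the boundedness
    required by \<open>accurate_to_order_bilinear\<close>.\<close>
  have bdd: "bounded (a ` cball x0 D)" if "continuous_on (cball x0 D) a"
    for a :: "real ^ 'd \<Rightarrow> 'z::real_normed_vector"
    using that by (intro compact_imp_bounded compact_continuous_image) auto
  note f_bdd = C2_function_continuous[OF C2(1), THEN bdd]
  note g_bdd = C2_function_continuous[OF C2(2), THEN bdd]
  note scaleR_acc = accurate_to_order_bilinear[OF bounded_bilinear_scaleR \<open>N \<ge> 0\<close>]
  note outer_acc = accurate_to_order_bilinear[OF bounded_bilinear_outer_product \<open>N \<ge> 0\<close>]
  have grad: "gradient (\<lambda>x. p x * q x) = (\<lambda>x. p x *\<^sub>R gradient q x + q x *\<^sub>R gradient p x)"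
    if "twice_differentiable p" "twice_differentiable q" for p q :: "real ^ 'd \<Rightarrow> real"
    using that by (intro gradient_mult) (auto simp: twice_differentiable_def)
  have "accurate_to_order N x0 D (gradient (\<lambda>x. f x * g x)) (\<lambda>\<Delta>. gradient (\<lambda>x. m \<Delta> x * k \<Delta> x))"
  proof (rule accurate_to_order_cong)
    show "accurate_to_order N x0 D (gradient (\<lambda>x. f x * g x))
      (\<lambda>\<Delta> x. m \<Delta> x *\<^sub>R gradient (k \<Delta>) x + k \<Delta> x *\<^sub>R gradient (m \<Delta>) x)"
      unfolding grad[OF td]
      by (rule accurate_to_order_add[OF scaleR_acc[OF f_acc(1) g_acc(2) f_bdd(1) g_bdd(2)]
            scaleR_acc[OF g_acc(1) f_acc(2) g_bdd(1) f_bdd(2)]])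
  qed (rule grad[OF tdm, symmetric])
  moreover
  have "accurate_to_order N x0 D (hessian (\<lambda>x. f x * g x)) (\<lambda>\<Delta>. hessian (\<lambda>x. m \<Delta> x * k \<Delta> x))"
  proof (rule accurate_to_order_cong)
    show "accurate_to_order N x0 D (hessian (\<lambda>x. f x * g x)) (\<lambda>\<Delta> x.
        (m \<Delta> x *\<^sub>R hessian (k \<Delta>) x + outer_product (gradient (k \<Delta>) x) (gradient (m \<Delta>) x)) +
        (k \<Delta> x *\<^sub>R hessian (m \<Delta>) x + outer_product (gradient (m \<Delta>) x) (gradient (k \<Delta>) x)))"
      unfolding hessian_mult(2)[OF td]
      \<comment> \<open>The nesting mirrors the bracketing of the four terms in
        \<open>hessian_mult\<close>.\<close>
      by (rule accurate_to_order_add[OF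
            accurate_to_order_add[OF scaleR_acc[OF f_acc(1) g_acc(3) f_bdd(1) g_bdd(3)]
              outer_acc[OF g_acc(2) f_acc(2) g_bdd(2) f_bdd(2)]]
            accurate_to_order_add[OF scaleR_acc[OF g_acc(1) f_acc(3) g_bdd(1) f_bdd(3)]
              outer_acc[OF f_acc(2) g_acc(2) f_bdd(2) g_bdd(2)]]])
  qed (rule hessian_mult(2)[OF tdm, symmetric])
  moreover have "accurate_to_order N x0 D (\<lambda>x. f x * g x) (\<lambda>\<Delta> x. m \<Delta> x * k \<Delta> x)"
    by (rule accurate_to_order_bilinear[OF bounded_bilinear_mult \<open>N \<ge> 0\<close>
          f_acc(1) g_acc(1) f_bdd(1) g_bdd(1)])
  ultimately show ?thesis
    using C2_function_mult[OF C2] hessian_mult(1)[OF tdm] by (auto simp: C2_accurate_def)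
qed

text \<open>Induction over the index set; the empty product, and by convention the product over an
  infinite set, is the constant 1.\<close>

lemma C2_accurate_prod:
  assumes "N \<ge> 0" "\<And>i. i \<in> I \<Longrightarrow> C2_accurate N (f i) x0 D (m i)"
  shows "C2_accurate N (\<lambda>x. \<Prod>i\<in>I. f i x) x0 D (\<lambda>\<Delta> x. \<Prod>i\<in>I. m i \<Delta> x)"
  using assms(2)
  by (induction I rule: infinite_finite_induct)
    (auto intro: C2_accurate_const C2_accurate_mult[OF assms(1)])

theorem theorem20:
  fixes n :: nat
    and x0 :: "real ^ 'd"
    and Dbar :: real
    and f :: "nat \<Rightarrow> real ^ 'd \<Rightarrow> real"
    and m :: "nat \<Rightarrow> real \<Rightarrow> real ^ 'd \<Rightarrow> real"
    and Nf Ng Nh :: "nat \<Rightarrow> real"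
  assumes "n \<ge> 1"
    and "Dbar > 0"
    and "\<And>i. i \<in> {1..n} \<Longrightarrow> C2_function (f i)"
    and "\<And>i \<Delta>. i \<in> {1..n} \<Longrightarrow> \<Delta> \<in> {0<..Dbar} \<Longrightarrow> twice_differentiable (m i \<Delta>)"
    and "\<And>i. i \<in> {1..n} \<Longrightarrow> Nf i \<ge> 0 \<and> Ng i \<ge> 0 \<and> Nh i \<ge> 0"
    and "\<And>i. i \<in> {1..n} \<Longrightarrow> function_accuracy (Nf i) (f i) x0 Dbar (m i)"
    and "\<And>i. i \<in> {1..n} \<Longrightarrow> gradient_accuracy (Ng i) (f i) x0 Dbar (m i)"
    and "\<And>i. i \<in> {1..n} \<Longrightarrow> hessian_accuracy (Nh i) (f i) x0 Dbar (m i)"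
  shows "hessian_accuracy (Min (Nf ` {1..n} \<union> Ng ` {1..n} \<union> Nh ` {1..n}))
           (\<lambda>x. \<Prod>i\<in>{1..n}. f i x) x0 Dbar (\<lambda>\<Delta> x. \<Prod>i\<in>{1..n}. m i \<Delta> x)"
proof -
  define N where "N = Min (Nf ` {1..n} \<union> Ng ` {1..n} \<union> Nh ` {1..n})"
  \<comment> \<open>As \<open>n \<ge> 1\<close>, the minimum is taken over a nonempty finite set, so
    it is one of the nonnegative orders.\<close>
  have "N \<ge> 0"
    unfolding N_def using assms(1,5) by (subst Min_ge_iff) auto
  have N: "N \<le> Nf i" "N \<le> Ng i" "N \<le> Nh i" if "i \<in> {1..n}" for i
    unfolding N_def using that by (auto intro!: Min_le)
  have "C2_accurate N (f i) x0 Dbar (m i)" if i: "i \<in> {1..n}" for i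
  proof -
    have "accurate_to_order (Nf i) x0 Dbar (f i) (m i)"
      using assms(6)[OF i] by (simp add: function_accuracy_def accurate_to_order_def)
    moreover have "accurate_to_order (Ng i) x0 Dbar (gradient (f i)) (\<lambda>\<Delta>. gradient (m i \<Delta>))"
      using assms(7)[OF i] by (simp add: gradient_accuracy_def accurate_to_order_def)
    moreover have "accurate_to_order (Nh i) x0 Dbar (hessian (f i)) (\<lambda>\<Delta>. hessian (m i \<Delta>))"
      using assms(8)[OF i] by (simp add: hessian_accuracy_iff)
    \<comment> \<open>All three orders are lowered to the common order \<open>N\<close>.\<close>
    ultimately show ?thesis
      using assms(3,4)[OF i] N[OF i] by (auto simp: C2_accurate_def intro: accurate_to_order_mono)
  qed
  then have "C2_accurate N (\<lambda>x. \<Prod>i\<in>{1..n}. f i x) x0 Dbar (\<lambda>\<Delta> x. \<Prod>i\<in>{1..n}. m i \<Delta> x)"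
    using \<open>N \<ge> 0\<close> by (intro C2_accurate_prod)
  then show ?thesis
    unfolding N_def[symmetric]
    by (auto simp: C2_accurate_def C2_function_def hessian_accuracy_iff)
qed

end
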